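(* Let $m\ge3$, $n\ge2$, and suppose $\mathcal{A}\in\mathbb{S}_{m,n}$ is copositive. Let $S=\mathrm{conv}\{\mathbf{u}_1,\dots,\mathbf{u}_n\}$ be a simplex in $\mathbb{R}^n$ with $\mathcal{A}\mathbf{u}_i^m>0$ for all $i\in[n]$, and let $V=(\mathbf{u}_1,\dots,\mathbf{u}_n)\in\mathbb{R}^{n\times n}$. If there exists $\tilde{\mathbf{x}}\in S\setminus\{\mathbf{u}_1,\dots,\mathbf{u}_n\}$ with $\mathcal{A}\tilde{\mathbf{x}}^m=0$, then $V^T\mathcal{A}V$ is not strictly copositive.
   Context: $\mathbb{S}_{m,n}$ denotes the set of real symmetric tensors of order $m$ and dimension $n$. $\mathcal{A}\mathbf{x}^m=\sum_{i_1,\dots,i_m}a_{i_1\cdots i_m}x_{i_1}\cdots x_{i_m}$. $\mathcal{A}$ is copositive (resp. strictly copositive) if $\mathcal{A}\mathbf{x}^m\ge0$ for all $\mathbf{x}\in\mathbb{R}^n_+$ (resp. $\mathcal{A}\mathbf{x}^m>0$ for all $\mathbf{x}\in\mathbb{R}^n_+\setminus\{\mathbf{0}\}$). For $V\in\mathbb{R}^{n\times n}$, $V^T\mathcal{A}V$ is the tensor with entries $(V^T\mathcal{A}V)_{i_1\cdots i_m}=\sum_{j_1,\dots,j_m}a_{j_1\cdots j_m}V_{j_1i_1}\cdots V_{j_mi_m}$. *)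

theory Defs
  imports "HOL-Analysis.Analysis"
begin

text \<open>
  A real tensor of order m and dimension n is indexed by multi-indices
  (i_1, ..., i_m), i.e. by functions from an m-element index type \<^typ>\<open>'m\<close> to an
  n-element index type \<^typ>\<open>'n\<close>; thus m = CARD('m) and n = CARD('n).
\<close>

type_synonym ('m, 'n) tensor = "real ^ ('m \<Rightarrow> 'n)"

definition symmetric_tensor :: "('m::finite, 'n::finite) tensor \<Rightarrow> bool" where
  "symmetric_tensor A \<longleftrightarrow> (\<forall>\<sigma> i. bij \<sigma> \<longrightarrow> A $ (i \<circ> \<sigma>) = A $ i)"

definition tensor_form :: "('m::finite, 'n::finite) tensor \<Rightarrow> real ^ 'n \<Rightarrow> real" where
  "tensor_form A x = (\<Sum>i\<in>UNIV. A $ i * (\<Prod>k\<in>UNIV. x $ i k))"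

definition nonneg_orthant :: "(real ^ 'n) set" where
  "nonneg_orthant = {x. \<forall>i. 0 \<le> x $ i}"

definition copositive :: "('m::finite, 'n::finite) tensor \<Rightarrow> bool" where
  "copositive A \<longleftrightarrow> (\<forall>x\<in>nonneg_orthant. tensor_form A x \<ge> 0)"

definition strictly_copositive :: "('m::finite, 'n::finite) tensor \<Rightarrow> bool" where
  "strictly_copositive A \<longleftrightarrow> (\<forall>x\<in>nonneg_orthant - {0}. tensor_form A x > 0)"

text \<open>This is \<open>V\<^sup>T A V\<close>; the summation index is the row index of V.\<close>

definition tensor_congruence ::
    "real ^ 'n ^ 'n \<Rightarrow> ('m::finite, 'n::finite) tensor \<Rightarrow> ('m, 'n) tensor" where
  "tensor_congruence V A = (\<chi> i. \<Sum>j\<in>UNIV. A $ j * (\<Prod>k\<in>UNIV. V $ j k $ i k))"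

end

theory Submission
  imports Defs
begin

text \<open>Substituting \<open>V *v c\<close> into the form of \<open>A\<close> yields the form of
  the congruent tensor at \<open>c\<close> (\<open>tensor_form_congruence\<close>). A point of the
  simplex is \<open>V *v c\<close>, where \<open>c\<close> lists its barycentric coordinates: a
  nonnegative, nonzero vector (\<open>convex_hull_columns_subset\<close>). So a zero of
  \<open>A\<close> in the simplex pulls back to a zero of the congruent form in the orthant away
  from the origin.\<close>

lemma tensor_form_congruence:
  fixes A :: "('m::finite, 'n::finite) tensor"
  shows "tensor_form (tensor_congruence V A) c = tensor_form A (V *v c)"
proof -
  \<comment> \<open>Distributivity: multiplying out one sum per position \<open>k\<close> leaves one
    term for each choice of summands, and such a choice is exactly a multi-index
    \<open>i\<close>.\<close>
  have expand: "(\<Sum>i\<in>UNIV. \<Prod>k\<in>UNIV. V $ j k $ i k * c $ i k) = (\<Prod>k\<in>UNIV. (V *v c) $ j k)"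
    for j :: "'m \<Rightarrow> 'n"
    using prod_sum_PiE[of "UNIV :: 'm set" "\<lambda>_. UNIV" "\<lambda>k l. V $ j k $ l * c $ l"]
    by (simp add: matrix_vector_mult_def PiE_UNIV_domain)
  have "tensor_form (tensor_congruence V A) c =
      (\<Sum>i\<in>UNIV. \<Sum>j\<in>UNIV. A $ j * (\<Prod>k\<in>UNIV. V $ j k $ i k * c $ i k))"
    by (simp add: tensor_form_def tensor_congruence_def sum_distrib_right prod.distrib mult.assoc)
  also have "\<dots> = (\<Sum>j\<in>UNIV. A $ j * (\<Sum>i\<in>UNIV. \<Prod>k\<in>UNIV. V $ j k $ i k * c $ i k))"
    by (subst sum.swap) (simp add: sum_distrib_left)
  finally show ?thesis
    by (simp add: expand tensor_form_def)
qed

text \<open>Linear maps commute with convex hulls and \<open>V\<close> sends \<open>axis j 1\<close>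
  to its column \<open>j\<close>, so it suffices to locate the hull of the standard basis
  vectors.\<close>

lemma convex_hull_columns_subset:
  fixes V :: "real ^ 'n::finite ^ 'm::finite"
  shows "convex hull (range (\<lambda>j. column j V)) \<subseteq> (*v) V ` (nonneg_orthant - {0})"
proof -
  \<comment> \<open>The standard simplex, a convex set containing the basis vectors.\<close>
  define D :: "(real ^ 'n) set" where "D = {c. (\<forall>i. 0 \<le> c $ i) \<and> (\<Sum>i\<in>UNIV. c $ i) = 1}"
  have "convex D"
    unfolding D_def convex_def
    by (auto simp: sum.distrib simp flip: sum_distrib_left)
  moreover have "range (\<lambda>j. axis j 1) \<subseteq> D"
    by (auto simp: D_def axis_def)
  ultimately have "convex hull (range (\<lambda>j. axis j 1)) \<subseteq> D"
    by (rule hull_minimal[rotated])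
  \<comment> \<open>Coordinates summing to 1 rule out the zero vector.\<close>
  also have "D \<subseteq> nonneg_orthant - {0}"
    by (auto simp: D_def nonneg_orthant_def)
  finally have "(*v) V ` (convex hull (range (\<lambda>j. axis j 1))) \<subseteq> (*v) V ` (nonneg_orthant - {0})"
    by (rule image_mono)
  then show ?thesis
    by (simp add: convex_hull_linear_image image_image matrix_vector_mult_basis)
qed

theorem theorem3p3:
  fixes A :: "('m::finite, 'n::finite) tensor"
    and u :: "'n \<Rightarrow> real ^ 'n"
    and S :: "(real ^ 'n) set"
    and V :: "real ^ 'n ^ 'n"
  assumes "CARD('m) \<ge> 3" and "CARD('n) \<ge> 2"
    and "symmetric_tensor A" and "copositive A"
    and "S = convex hull (range u)"
    and "(int CARD('n) - 1) simplex S"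
    and "\<forall>i. tensor_form A (u i) > 0"
    and "V = (\<chi> i j. u j $ i)"
    and "\<exists>x \<in> S - range u. tensor_form A x = 0"
  shows "\<not> strictly_copositive (tensor_congruence V A)"
proof -
  have "range u = range (\<lambda>j. column j V)"
    using assms(8) by (simp add: column_def)
  then have "S \<subseteq> (*v) V ` (nonneg_orthant - {0})"
    using convex_hull_columns_subset[of V] assms(5) by simp
  \<comment> \<open>\<open>c\<close> is a preimage under \<open>V\<close> of the given zero of
    \<open>A\<close> in \<open>S\<close>.\<close>
  then obtain c where "c \<in> nonneg_orthant - {0}" and "tensor_form A (V *v c) = 0"
    using assms(9) by blast
  then show ?thesis
    unfolding strictly_copositive_def by (metis tensor_form_congruence less_irrefl)
qed

end
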